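(* Let $M^\star\in\mathbb{R}^{n_1\times n_2}$ be a rank-$r$ matrix whose column space and row space are contained in $\mathrm{colspan}(\widetilde U)$ and $\mathrm{colspan}(\widetilde V)$ respectively, where $\widetilde U\in\mathbb{R}^{n_1\times s_1}$, $\widetilde V\in\mathbb{R}^{n_2\times s_2}$, $\widetilde U^\top\widetilde U=I_{s_1}$ and $\widetilde V^\top\widetilde V=I_{s_2}$. For $\theta=\mathrm{vec}(\Theta_A,\Theta_B)$ with $\Theta_A\in\mathbb{R}^{s_1\times r}$, $\Theta_B\in\mathbb{R}^{s_2\times r}$, set $X(\theta)=\widetilde U\Theta_A$ and $Y(\theta)=\widetilde V\Theta_B$. Then $M^\star$ and $(X(\cdot),Y(\cdot))$ satisfy the Correlated Parametric Factorization condition.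
   Context: $\mathrm{vec}(A,B)$ is the vector listing all entries of $A$ and $B$ in some fixed order; here $d=(s_1+s_2)r$. $A\succeq0$ means $A$ is symmetric positive semidefinite. Correlated Parametric Factorization condition for a rank-$r$ matrix $M^\star$ and linear maps $X:\mathbb{R}^d\to\mathbb{R}^{n_1\times r}$, $Y:\mathbb{R}^d\to\mathbb{R}^{n_2\times r}$: for every $\theta\in\mathbb{R}^d$ there exists $\xi\in\mathbb{R}^d$ (not necessarily unique) with $M^\star=X(\xi)Y(\xi)^\top$, $X(\xi)^\top X(\xi)=Y(\xi)^\top Y(\xi)$, and $X(\theta)^\top X(\xi)+Y(\theta)^\top Y(\xi)\succeq 0$. *)

theory Defs
  imports "HOL-Analysis.Analysis"
begin

definition psd :: "real^'n^'n \<Rightarrow> bool" where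
  "psd A \<longleftrightarrow> transpose A = A \<and> (\<forall>x. 0 \<le> x \<bullet> (A *v x))"

text \<open>
  The listing of all entries of two matrices in one vector. The order of the listing is
  given by \<open>e\<close>, which says what position of what matrix is found at coordinate \<open>k\<close>. When \<open>e\<close>
  is a bijection, the dimension of the vector is \<open>(s1 + s2) * r\<close> and every vector is the
  listing of exactly one pair of matrices; both facts are proved below.
\<close>

definition vec_pair ::
  "('d \<Rightarrow> ('s1 \<times> 'r) + ('s2 \<times> 'r)) \<Rightarrow> real^'r^'s1 \<Rightarrow> real^'r^'s2 \<Rightarrow> real^'d" where
  "vec_pair e A B = (\<chi> k. case e k of Inl (i, j) \<Rightarrow> A $ i $ j | Inr (i, j) \<Rightarrow> B $ i $ j)"

lemma card_vec_pair_index: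
  fixes e :: "'d::finite \<Rightarrow> ('s1::finite \<times> 'r::finite) + ('s2::finite \<times> 'r)"
  assumes "bij e"
  shows "CARD('d) = (CARD('s1) + CARD('s2)) * CARD('r)"
  using bij_betw_same_card[OF assms] by (simp add: algebra_simps)

lemma bij_vec_pair:
  fixes e :: "'d::finite \<Rightarrow> ('s1::finite \<times> 'r::finite) + ('s2::finite \<times> 'r)"
  assumes e: "bij e"
  shows "bij (\<lambda>(A, B). vec_pair e A B)"
proof (rule bijI)
  have e': "e (inv e z) = z" for z
    using e by (simp add: bij_is_surj surj_f_inv_f)
  have at_Inl: "vec_pair e A B $ inv e (Inl (i, j)) = A $ i $ j"
    and at_Inr: "vec_pair e A B $ inv e (Inr (i', j)) = B $ i' $ j" for A B i i' j
    by (simp_all add: vec_pair_def e')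
  show "inj (\<lambda>(A, B). vec_pair e A B)"
  proof (rule injI, clarify)
    fix A B A' B'
    assume "vec_pair e A B = vec_pair e A' B'"
    then show "A = A' \<and> B = B'"
      by (metis at_Inl at_Inr vec_eq_iff)
  qed
  show "surj (\<lambda>(A, B). vec_pair e A B)"
  proof (rule surjI)
    fix \<theta> :: "real^'d"
    show "(case (\<chi> i j. \<theta> $ inv e (Inl (i, j)), \<chi> i j. \<theta> $ inv e (Inr (i, j))) of
            (A, B) \<Rightarrow> vec_pair e A B) = \<theta>"
      using bij_is_inj[OF e]
      by (auto simp: vec_pair_def vec_eq_iff split: sum.splits) (metis inv_f_f)+
  qed
qed

definition correlated_parametric_factorization ::
  "real^'n2^'n1 \<Rightarrow> (real^'d \<Rightarrow> real^'r^'n1) \<Rightarrow> (real^'d \<Rightarrow> real^'r^'n2) \<Rightarrow> bool" where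
  "correlated_parametric_factorization M X Y \<longleftrightarrow>
     rank M = CARD('r) \<and> linear X \<and> linear Y \<and>
     (\<forall>\<theta>. \<exists>\<xi>. M = X \<xi> ** transpose (Y \<xi>)
          \<and> transpose (X \<xi>) ** X \<xi> = transpose (Y \<xi>) ** Y \<xi>
          \<and> psd (transpose (X \<theta>) ** X \<xi> + transpose (Y \<theta>) ** Y \<xi>))"

end

theory Submission
  imports Defs
begin

text \<open>
  Since the column and row spaces of \<open>M\<close> lie in those of \<open>U\<close> and \<open>V\<close>, we have
  \<open>M = U N V\<^sup>T\<close> with \<open>N = U\<^sup>T M V\<close>, and multiplication by \<open>U\<close> or \<open>V\<close> preserves inner
  products of columns. So the problem is one about \<open>N\<close> alone: find \<open>P\<close>, \<open>Q\<close> with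
  \<open>N = P Q\<^sup>T\<close> and \<open>P\<^sup>T P = Q\<^sup>T Q\<close> such that \<open>C = A\<^sup>T P + B\<^sup>T Q\<close> is positive semidefinite,
  where \<open>\<theta>\<close> lists the entries of \<open>A\<close> and \<open>B\<close>. Replacing \<open>(P, Q)\<close> by \<open>(P R, Q R)\<close> with
  \<open>R\<close> orthogonal keeps the first two properties and turns \<open>C\<close> into \<open>C R\<close>. It therefore
  suffices to know that a balanced factorization exists (\<open>balanced_factorization_exists\<close>)
  and that every square \<open>C\<close> has an orthogonal \<open>R\<close> with \<open>C R\<close> positive semidefinite
  (\<open>polar_rotation_exists\<close>).

  Both are usually read off a singular value decomposition. Here both come instead from a
  nearest-point problem on a closed set: among all factorizations of \<open>N\<close> the one of least
  norm is balanced, and the orthogonal matrix nearest to \<open>C\<^sup>T\<close> is the required \<open>R\<close>.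
  In both cases the optimality condition is obtained by comparing with the competitors that
  arise by stretching the factor along a single direction \<open>v\<close>; a stretch by \<open>-1\<close> is a
  reflection.
\<close>

section \<open>Stretching along one direction\<close>

text \<open>
  Dividing by \<open>v \<bullet> v\<close> spares all normalizations later. For \<open>v = 0\<close> the quotient is \<open>0\<close> and
  the matrix is the identity, so the algebraic laws below hold for every \<open>v\<close>.
\<close>

definition stretch :: "real \<Rightarrow> real^'n \<Rightarrow> real^'n^'n" where
  "stretch a v = mat 1 + ((a - 1) / (v \<bullet> v)) *\<^sub>R (\<chi> i j. v $ i * v $ j)"

lemma stretch_mult_vec:
  "stretch a v *v x = x + ((a - 1) / (v \<bullet> v) * (v \<bullet> x)) *\<^sub>R v"
proof -
  have "(\<chi> i j. v $ i * v $ j) *v x = (v \<bullet> x) *\<^sub>R v"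
    by (simp add: vec_eq_iff matrix_vector_mult_def inner_vec_def sum_distrib_left
        sum_distrib_right mult.commute mult.left_commute)
  then show ?thesis
    by (simp add: stretch_def matrix_vector_mult_add_rdistrib scaleR_matrix_vector_assoc[symmetric])
qed

lemma transpose_stretch [simp]: "transpose (stretch a v) = stretch a v"
  by (simp add: stretch_def transpose_def vec_eq_iff mat_def mult.commute)

lemma stretch_mult_stretch: "stretch a v ** stretch b v = stretch (a * b) v"
proof (cases "v = 0")
  case True
  then show ?thesis by (simp add: matrix_eq stretch_mult_vec flip: matrix_vector_mul_assoc)
next
  case False
  then have nz: "v \<bullet> v \<noteq> 0" by simp
  have "stretch a v *v (stretch b v *v x) = stretch (a * b) v *v x" for x
  proof -
    let ?k = "(v \<bullet> x) / (v \<bullet> v)"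
    have "v \<bullet> (stretch b v *v x) = b * (v \<bullet> x)"
      using nz by (simp add: stretch_mult_vec inner_add_right field_simps)
    then have "stretch a v *v (stretch b v *v x)
        = x + ((b - 1) * ?k) *\<^sub>R v + ((a - 1) * (b * ?k)) *\<^sub>R v"
      unfolding stretch_mult_vec[of a] by (simp add: stretch_mult_vec)
    also have "\<dots> = x + ((b - 1) * ?k + (a - 1) * (b * ?k)) *\<^sub>R v"
      by (simp only: scaleR_add_left add.assoc)
    also have "(b - 1) * ?k + (a - 1) * (b * ?k) = (a * b - 1) * ?k"
      by (simp only: algebra_simps)
    finally show ?thesis by (simp add: stretch_mult_vec)
  qed
  then show ?thesis by (simp add: matrix_eq flip: matrix_vector_mul_assoc)
qed

lemma stretch_1 [simp]: "stretch 1 v = mat 1"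
  by (simp add: stretch_def)

lemma trace_mult_stretch:
  fixes S :: "real^'n^'n"
  shows "trace (S ** stretch a v) = trace S + (a - 1) / (v \<bullet> v) * (v \<bullet> (S *v v))"
proof -
  have "trace (S ** (\<chi> i j. v $ i * v $ j)) = v \<bullet> (S *v v)"
    by (simp add: trace_def matrix_matrix_mult_def matrix_vector_mult_def inner_vec_def
        sum_distrib_left mult.commute mult.left_commute)
  moreover have "trace (c *\<^sub>R A) = c * trace A" for c and A :: "real^'n^'n"
    by (simp add: trace_def sum_distrib_left)
  ultimately show ?thesis
    by (simp add: stretch_def matrix_add_ldistrib trace_add matrix_scalar_ac
        flip: scalar_matrix_assoc)
qed

lemma inner_matrix_eq_trace:
  fixes A B :: "real^'n^'m"
  shows "A \<bullet> B = trace (transpose A ** B)"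
proof -
  have "A \<bullet> B = (\<Sum>i\<in>UNIV. \<Sum>j\<in>UNIV. A $ i $ j * B $ i $ j)"
    by (simp add: inner_vec_def)
  also have "\<dots> = (\<Sum>j\<in>UNIV. \<Sum>i\<in>UNIV. A $ i $ j * B $ i $ j)"
    by (rule sum.swap)
  finally show ?thesis
    by (simp add: trace_def matrix_matrix_mult_def transpose_def)
qed

lemma matrix_add_rdistrib: "(A + B) ** C = A ** C + B ** C"
  by (simp add: matrix_matrix_mult_def vec_eq_iff distrib_right sum.distrib)

lemma inner_mult_vec_gram:
  fixes A B :: "real^'n^'m"
  shows "x \<bullet> ((transpose A ** B) *v y) = (A *v x) \<bullet> (B *v y)"
  by (metis dot_lmul_matrix matrix_vector_mul_assoc vector_transpose_matrix transpose_matrix_vector)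

lemma matrix_entry_inner_axis:
  fixes S :: "real^'n^'m"
  shows "S $ i $ j = axis i 1 \<bullet> (S *v axis j 1)"
  by (simp add: inner_axis' matrix_vector_mult_basis column_def)

lemma norm_mult_stretch:
  fixes P :: "real^'n^'m"
  shows "(norm (P ** stretch a v))\<^sup>2
     = (norm P)\<^sup>2 + (a\<^sup>2 - 1) / (v \<bullet> v) * (norm (P *v v))\<^sup>2"
proof -
  have "(norm (P ** stretch a v))\<^sup>2
      = trace (stretch a v ** (transpose P ** P ** stretch a v))"
    by (simp add: power2_norm_eq_inner inner_matrix_eq_trace matrix_transpose_mul matrix_mul_assoc)
  also have "\<dots> = trace (transpose P ** P ** (stretch a v ** stretch a v))"
    by (subst trace_mul_sym) (simp add: matrix_mul_assoc)
  also have "\<dots> = trace (transpose P ** P) + (a\<^sup>2 - 1) / (v \<bullet> v) * (v \<bullet> ((transpose P ** P) *v v))"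
    by (simp add: stretch_mult_stretch trace_mult_stretch power2_eq_square)
  finally show ?thesis
    by (simp add: inner_mult_vec_gram power2_norm_eq_inner inner_matrix_eq_trace)
qed

section \<open>Balanced factorizations\<close>

lemma span_columns_eq_range: "span (columns A) = range ((*v) A)" for A :: "real^'n^'m"
proof
  have "columns A \<subseteq> range ((*v) A)"
    by (auto simp: columns_def simp flip: matrix_vector_mult_basis)
  then show "span (columns A) \<subseteq> range ((*v) A)"
    by (intro span_minimal linear_subspace_image) auto
qed (auto intro: matrix_vector_mult_in_columnspace)

lemma rank_factorization_exists:
  fixes M :: "real^'n^'m"
  assumes "rank M \<le> CARD('r::finite)"
  obtains P :: "real^'r^'m" and Q :: "real^'r^'n" where "M = P ** transpose Q"
proof -
  obtain B where B: "B \<subseteq> columns M" "independent B" "columns M \<subseteq> span B"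
      "card B = dim (columns M)"
    using basis_exists by blast
  have "finite B" using B(2) by (rule independent_imp_finite)
  moreover have "card B \<le> card (UNIV :: 'r set)"
    using assms B(4) by (simp add: column_rank_def)
  ultimately obtain g :: "real^'m \<Rightarrow> 'r" where g: "inj_on g B"
    by (metis card_le_inj finite_class.finite_UNIV)
  \<comment> \<open>The columns of \<open>P\<close> are the basis vectors; the surplus ones are arbitrary.\<close>
  define f where "f = inv_into B g"
  define P :: "real^'r^'m" where "P = (\<chi> i k. f k $ i)"
  have "B \<subseteq> columns P"
  proof
    fix b assume "b \<in> B"
    then have "column (g b) P = b"
      using g by (simp add: column_def P_def f_def vec_eq_iff)
    then show "b \<in> columns P" by (auto simp: columns_def intro: exI[of _ "g b"])
  qed
  then have "columns M \<subseteq> range ((*v) P)"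
    using B(3) span_mono[of B "columns P"] by (simp add: span_columns_eq_range)
  then have "\<exists>q. column j M = P *v q" for j
    by (auto simp: columns_def)
  then obtain q where q: "\<And>j. column j M = P *v q j" by metis
  have "M = P ** transpose (\<chi> j. q j)"
    using q by (simp add: vec_eq_iff column_def matrix_vector_mult_def matrix_matrix_mult_def
        transpose_def)
  then show ?thesis by (rule that)
qed

text \<open>
  With \<open>p = |P v|\<^sup>2\<close>, \<open>q = |Q v|\<^sup>2\<close> and \<open>t\<close> the squared stretching factor, this is the
  optimality condition of a factorization of least norm.
\<close>

lemma balanced_if_no_rescaling_gains:
  fixes p q :: real
  assumes "p \<ge> 0" "q \<ge> 0" and opt: "\<And>t. t > 0 \<Longrightarrow> 0 \<le> (t - 1) * p + (1 / t - 1) * q"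
  shows "p = q"
proof (cases "q = 0")
  case True
  then show ?thesis using opt[of "1/2"] \<open>p \<ge> 0\<close> by simp
next
  case False
  then have "q > 0" "p + q > 0" using assms by auto
  \<comment> \<open>The bound in \<open>opt\<close> is \<open>(t - 1) (p - q / t)\<close>. If \<open>p \<noteq> q\<close>, it is negative for \<open>t\<close> strictly
     between \<open>1\<close> and \<open>q / p\<close> (read as infinity when \<open>p = 0\<close>); \<open>2 q / (p + q)\<close> is such a \<open>t\<close>.\<close>
  then have "0 \<le> (2 * q / (p + q) - 1) * p + (1 / (2 * q / (p + q)) - 1) * q"
    by (intro opt) simp
  also have "(2 * q / (p + q) - 1) * p = (q - p) * p / (p + q)"
    using \<open>p + q > 0\<close> by (simp add: field_simps)
  also have "(1 / (2 * q / (p + q)) - 1) * q = (p - q) / 2"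
    using \<open>q > 0\<close> \<open>p + q > 0\<close> by (simp add: field_simps)
  also have "(q - p) * p / (p + q) + (p - q) / 2 = - ((p - q)\<^sup>2 / (2 * (p + q)))"
    using \<open>p + q > 0\<close> by (simp add: field_simps power2_eq_square)
  finally have "(p - q)\<^sup>2 \<le> 0"
    using \<open>p + q > 0\<close> by (simp add: divide_le_0_iff)
  then show ?thesis by simp
qed

lemma gram_eq_if_norms_eq:
  fixes P :: "real^'n^'m" and Q :: "real^'n^'k"
  assumes "\<And>v. norm (P *v v) = norm (Q *v v)"
  shows "transpose P ** P = transpose Q ** Q"
proof -
  have "(P *v x) \<bullet> (P *v y) = (Q *v x) \<bullet> (Q *v y)" for x y
    using assms[of x] assms[of y] assms[of "x + y"]
    by (simp add: dot_norm matrix_vector_right_distrib)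
  then show ?thesis
    by (simp add: vec_eq_iff matrix_entry_inner_axis inner_mult_vec_gram)
qed

text \<open>
  A factorization \<open>N = P Q\<^sup>T\<close> of least norm exists because the set of all factorizations is
  closed. Stretching \<open>P\<close> by \<open>a\<close> and \<open>Q\<close> by \<open>1 / a\<close> along \<open>v\<close> does not change the product, so
  minimality forces \<open>|P v| = |Q v|\<close>.
\<close>

lemma balanced_factorization_exists:
  fixes N :: "real^'n^'m"
  assumes "rank N \<le> CARD('r::finite)"
  obtains P :: "real^'r^'m" and Q :: "real^'r^'n"
  where "N = P ** transpose Q" "transpose P ** P = transpose Q ** Q"
proof -
  define F where "F = {(P :: real^'r^'m, Q :: real^'r^'n). P ** transpose Q = N}"
  have "closed F"
  proof -
    have "F = {z. (\<chi> i j. \<Sum>k\<in>UNIV. fst z $ i $ k * snd z $ j $ k) = N}"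
      by (auto simp: F_def matrix_matrix_mult_def transpose_def)
    then show ?thesis
      by (auto intro!: closed_Collect_eq continuous_intros)
  qed
  moreover have "F \<noteq> {}"
  proof -
    obtain P :: "real^'r^'m" and Q :: "real^'r^'n" where "N = P ** transpose Q"
      using assms by (rule rank_factorization_exists)
    then have "(P, Q) \<in> F" by (simp add: F_def)
    then show ?thesis by blast
  qed
  ultimately obtain z where "z \<in> F" and z: "\<And>y. y \<in> F \<Longrightarrow> dist 0 z \<le> dist 0 y"
    using distance_attains_inf by metis
  obtain P Q where [simp]: "z = (P, Q)" by fastforce
  have PQ: "P ** transpose Q = N" using \<open>z \<in> F\<close> by (simp add: F_def)
  have least: "(norm P)\<^sup>2 + (norm Q)\<^sup>2 \<le> (norm P')\<^sup>2 + (norm Q')\<^sup>2"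
    if "P' ** transpose Q' = N" for P' :: "real^'r^'m" and Q' :: "real^'r^'n"
    using z[of "(P', Q')"] that by (simp add: F_def norm_Pair)
  have "norm (P *v v) = norm (Q *v v)" for v
  proof (cases "v = 0")
    case False
    let ?p = "(norm (P *v v))\<^sup>2" and ?q = "(norm (Q *v v))\<^sup>2"
    have "0 \<le> (t - 1) * ?p + (1 / t - 1) * ?q" if "t > 0" for t
    proof -
      let ?P = "P ** stretch (sqrt t) v" and ?Q = "Q ** stretch (1 / sqrt t) v"
      have "?P ** transpose ?Q
          = P ** (stretch (sqrt t) v ** stretch (1 / sqrt t) v) ** transpose Q"
        by (simp add: matrix_transpose_mul matrix_mul_assoc)
      also have "\<dots> = N" using PQ that by (simp add: stretch_mult_stretch)
      finally have "(norm P)\<^sup>2 + (norm Q)\<^sup>2 \<le> (norm ?P)\<^sup>2 + (norm ?Q)\<^sup>2" by (rule least)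
      then have "0 \<le> ((t - 1) * ?p + (1 / t - 1) * ?q) / (v \<bullet> v)"
        using that by (simp add: norm_mult_stretch power_divide add_divide_distrib)
      then show ?thesis using False
        by (simp add: zero_le_divide_iff flip: power2_norm_eq_inner)
    qed
    then have "?p = ?q" by (intro balanced_if_no_rescaling_gains) auto
    then show ?thesis by simp
  qed simp
  then show ?thesis using that PQ gram_eq_if_norms_eq by metis
qed

section \<open>Rotating a square matrix into a positive semidefinite one\<close>

lemma closed_orthogonal_matrices: "closed {R :: real^'n^'n. orthogonal_matrix R}"
proof -
  have "{R :: real^'n^'n. orthogonal_matrix R}
      = {R. (\<chi> i j. \<Sum>k\<in>UNIV. R $ k $ i * R $ k $ j) = (mat 1 :: real^'n^'n)}"
    by (auto simp: orthogonal_matrix matrix_matrix_mult_def transpose_def)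
  then show ?thesis
    by (auto intro!: closed_Collect_eq continuous_intros)
qed

lemma orthogonal_matrix_reflection: "orthogonal_matrix (stretch (-1) v)"
  by (simp add: orthogonal_matrix stretch_mult_stretch)

text \<open>
  Multiplying \<open>S\<close> by the reflection along \<open>v\<close> changes the trace by a negative multiple
  of \<open>v \<bullet> S v\<close>, which gives semidefiniteness. Symmetry comes from rotations,
  which are products of two reflections: for small angles the change of the trace is governed
  by its linear part, the antisymmetric part of \<open>S\<close>.
\<close>

lemma psd_if_trace_maximal:
  fixes S :: "real^'n^'n"
  assumes max: "\<And>R. orthogonal_matrix R \<Longrightarrow> trace (S ** R) \<le> trace S"
  shows "psd S"
proof -
  have nonneg: "0 \<le> v \<bullet> (S *v v)" for v
  proof (cases "v = 0")
    case False
    have "trace (S ** stretch (-1) v) \<le> trace S"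
      by (intro max orthogonal_matrix_reflection)
    then show ?thesis using False
      by (simp add: trace_mult_stretch zero_le_divide_iff flip: power2_norm_eq_inner)
  qed simp
  have sym: "w \<bullet> (S *v v) = v \<bullet> (S *v w)"
    if v: "v \<bullet> v = 1" and w: "w \<bullet> w = 1" and vw: "v \<bullet> w = 0" for v w
  proof -
    define \<alpha> where "\<alpha> = v \<bullet> (S *v v) + w \<bullet> (S *v w)"
    define \<beta> where "\<beta> = w \<bullet> (S *v v) - v \<bullet> (S *v w)"
    have "\<alpha> \<ge> 0" using nonneg by (simp add: \<alpha>_def)
    have quad: "0 \<le> t\<^sup>2 * \<alpha> + t * \<beta>" for t
    proof -
      define u where "u = v + t *\<^sub>R w"
      have uu: "u \<bullet> u = 1 + t\<^sup>2" and uv: "u \<bullet> v = 1"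
        using v w vw by (simp_all add: u_def inner_add inner_commute power2_eq_square)
      have pos: "1 + t\<^sup>2 > 0" by (simp add: add_pos_nonneg)
      have "orthogonal_matrix (stretch (-1) u ** stretch (-1) v)"
        by (intro orthogonal_matrix_mul orthogonal_matrix_reflection)
      then have "trace (S ** stretch (-1) u ** stretch (-1) v) \<le> trace S"
        by (metis max matrix_mul_assoc)
      then have "0 \<le> u \<bullet> (S *v u) / (1 + t\<^sup>2) + v \<bullet> (S *v (v - (2 / (1 + t\<^sup>2)) *\<^sub>R u))"
        by (simp add: trace_mult_stretch uu uv v stretch_mult_vec flip: matrix_vector_mul_assoc)
      also have "\<dots> = (u \<bullet> (S *v u) + (1 + t\<^sup>2) * (v \<bullet> (S *v v)) - 2 * (v \<bullet> (S *v u))) / (1 + t\<^sup>2)"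
        using pos by (simp add: matrix_vector_mult_diff_distrib matrix_vector_mult_scaleR
            inner_diff_right add_divide_distrib diff_divide_distrib)
      finally have "0 \<le> u \<bullet> (S *v u) + (1 + t\<^sup>2) * (v \<bullet> (S *v v)) - 2 * (v \<bullet> (S *v u))"
        using pos by (simp add: zero_le_divide_iff)
      also have "\<dots> = t\<^sup>2 * \<alpha> + t * \<beta>"
        by (simp add: u_def \<alpha>_def \<beta>_def matrix_vector_right_distrib matrix_vector_mult_scaleR
            inner_add algebra_simps power2_eq_square)
      finally show ?thesis .
    qed
    \<comment> \<open>Any small \<open>t\<close> with the sign of \<open>- \<beta>\<close> would do.\<close>
    define k where "k = \<beta> / (\<alpha> + 1)"
    have k: "\<beta> = k * (\<alpha> + 1)" using \<open>\<alpha> \<ge> 0\<close> by (simp add: k_def)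
    have "0 \<le> (- k)\<^sup>2 * \<alpha> + (- k) * \<beta>" by (rule quad)
    also have "\<dots> = - k\<^sup>2" by (simp add: k algebra_simps power2_eq_square)
    finally have "\<beta> = 0" by (simp add: k)
    then show ?thesis by (simp add: \<beta>_def)
  qed
  have "S $ j $ i = S $ i $ j" for i j
  proof (cases "i = j")
    case False
    then show ?thesis
      using sym[of "axis i 1" "axis j 1"]
      by (simp add: matrix_entry_inner_axis inner_axis_axis)
  qed simp
  then have "transpose S = S" by (simp add: vec_eq_iff transpose_def)
  with nonneg show ?thesis by (simp add: psd_def)
qed

text \<open>
  All orthogonal matrices have the same norm, so the one nearest to \<open>C\<^sup>T\<close> maximizes the
  inner product \<open>C\<^sup>T \<bullet> R\<close>, which is the trace of \<open>C R\<close>.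
\<close>

lemma polar_rotation_exists:
  fixes C :: "real^'n^'n"
  obtains R where "orthogonal_matrix R" "psd (C ** R)"
proof -
  have "{R :: real^'n^'n. orthogonal_matrix R} \<noteq> {}"
    using orthogonal_matrix_id by blast
  then obtain R :: "real^'n^'n" where "R \<in> {R. orthogonal_matrix R}"
    and "\<And>R'. R' \<in> {R. orthogonal_matrix R} \<Longrightarrow> dist (transpose C) R \<le> dist (transpose C) R'"
    by (rule distance_attains_inf[where a = "transpose C", OF closed_orthogonal_matrices]) blast
  then have R: "orthogonal_matrix R"
    and near: "\<And>R'. orthogonal_matrix R' \<Longrightarrow> dist (transpose C) R \<le> dist (transpose C) R'"
    by simp_all
  have dist: "(dist (transpose C) R')\<^sup>2
      = (norm (transpose C))\<^sup>2 - 2 * trace (C ** R') + trace (mat 1 :: real^'n^'n)"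
    if "orthogonal_matrix R'" for R'
  proof -
    have "R' \<bullet> R' = trace (mat 1 :: real^'n^'n)"
      using that by (simp add: inner_matrix_eq_trace orthogonal_matrix)
    moreover have "transpose C \<bullet> R' = trace (C ** R')"
      by (simp add: inner_matrix_eq_trace)
    ultimately show ?thesis
      by (simp add: dist_norm power2_norm_eq_inner inner_diff inner_commute)
  qed
  have "trace (C ** R ** R') \<le> trace (C ** R)" if "orthogonal_matrix R'" for R'
  proof -
    have RR': "orthogonal_matrix (R ** R')" using R that by (rule orthogonal_matrix_mul)
    then have "(dist (transpose C) R)\<^sup>2 \<le> (dist (transpose C) (R ** R'))\<^sup>2"
      using near by (intro power_mono) auto
    then show ?thesis using dist[OF R] dist[OF RR'] by (simp add: matrix_mul_assoc)
  qed
  then show ?thesis using that R psd_if_trace_maximal by blast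
qed

section \<open>Factors constrained to given column spaces\<close>

text \<open>\<open>U U\<^sup>T\<close> is the orthogonal projection onto the column space of \<open>U\<close>.\<close>

lemma projection_fixes_matrix:
  fixes U :: "real^'s^'n" and M :: "real^'m^'n"
  assumes "transpose U ** U = mat 1" and "span (columns M) \<subseteq> span (columns U)"
  shows "U ** (transpose U ** M) = M"
proof -
  have "U ** (transpose U ** M) *v x = M *v x" for x
  proof -
    have "M *v x \<in> span (columns U)"
      using assms(2) matrix_vector_mult_in_columnspace by blast
    then obtain y where y: "M *v x = U *v y"
      by (auto simp: span_columns_eq_range)
    then have "U ** (transpose U ** M) *v x = (U ** (transpose U ** U)) *v y"
      by (metis matrix_vector_mul_assoc)
    then show ?thesis using assms(1) y by simp
  qed
  then show ?thesis by (simp add: matrix_eq)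
qed

lemma vec_pair_add: "vec_pair e A B + vec_pair e A' B' = vec_pair e (A + A') (B + B')"
  by (auto simp: vec_pair_def vec_eq_iff split: sum.split)

lemma vec_pair_scaleR: "c *\<^sub>R vec_pair e A B = vec_pair e (c *\<^sub>R A) (c *\<^sub>R B)"
  by (auto simp: vec_pair_def vec_eq_iff split: sum.split)

lemma vec_pair_cases:
  fixes e :: "'d::finite \<Rightarrow> ('s1::finite \<times> 'r::finite) + ('s2::finite \<times> 'r)"
  assumes "bij e"
  obtains A B where "\<theta> = vec_pair e A B"
proof -
  obtain AB where "\<theta> = (case AB of (A, B) \<Rightarrow> vec_pair e A B)"
    using bij_is_surj[OF bij_vec_pair[OF assms]] by (rule surjE)
  then show ?thesis by (cases AB) (simp add: that)
qed

lemma linear_if_linear_on_vec_pair: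
  fixes e :: "'d::finite \<Rightarrow> ('s1::finite \<times> 'r::finite) + ('s2::finite \<times> 'r)"
    and f :: "real^'d \<Rightarrow> 'a::real_vector"
  assumes "bij e" and f: "\<And>A B. f (vec_pair e A B) = g (A, B)" and "linear g"
  shows "linear f"
proof (rule linearI)
  fix x y and c :: real
  obtain A B where x: "x = vec_pair e A B" using \<open>bij e\<close> by (rule vec_pair_cases)
  obtain A' B' where y: "y = vec_pair e A' B'" using \<open>bij e\<close> by (rule vec_pair_cases)
  show "f (x + y) = f x + f y"
    using linear_add[OF \<open>linear g\<close>, of "(A, B)" "(A', B')"] by (simp add: x y f vec_pair_add)
  show "f (c *\<^sub>R x) = c *\<^sub>R f x"
    using linear_scale[OF \<open>linear g\<close>, of c "(A, B)"] by (simp add: x f vec_pair_scaleR)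
qed

theorem lemma2p2:
  fixes M :: "real^'n2^'n1"
    and U :: "real^'s1^'n1"
    and V :: "real^'s2^'n2"
    and e :: "'d::finite \<Rightarrow> ('s1 \<times> 'r::finite) + ('s2 \<times> 'r)"
    and X :: "real^'d \<Rightarrow> real^'r^'n1"
    and Y :: "real^'d \<Rightarrow> real^'r^'n2"
  assumes "rank M = CARD('r)"
    and "span (columns M) \<subseteq> span (columns U)"
    and "span (rows M) \<subseteq> span (columns V)"
    and "transpose U ** U = mat 1"
    and "transpose V ** V = mat 1"
    and "bij e"
    and "\<And>A B. X (vec_pair e A B) = U ** A"
    and "\<And>A B. Y (vec_pair e A B) = V ** B"
  shows "correlated_parametric_factorization M X Y"
  unfolding correlated_parametric_factorization_def
proof (intro conjI allI)
  note X = assms(7) and Y = assms(8)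
  show "rank M = CARD('r)" by fact
  show "linear X"
    by (rule linear_if_linear_on_vec_pair[where g = "\<lambda>(A, B). U ** A", OF \<open>bij e\<close>])
      (auto simp: X matrix_add_ldistrib matrix_scalar_ac
        intro!: linearI simp flip: scalar_matrix_assoc)
  show "linear Y"
    by (rule linear_if_linear_on_vec_pair[where g = "\<lambda>(A, B). V ** B", OF \<open>bij e\<close>])
      (auto simp: Y matrix_add_ldistrib matrix_scalar_ac
        intro!: linearI simp flip: scalar_matrix_assoc)

  define N where "N = transpose U ** M ** V"
  have "U ** (transpose U ** M) = M"
    using assms(4,2) by (rule projection_fixes_matrix)
  moreover have "M ** V ** transpose V = M"
  proof -
    have "V ** (transpose V ** transpose M) = transpose M"
      using assms(5,3) by (intro projection_fixes_matrix) simp_all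
    from arg_cong[OF this, of transpose] show ?thesis
      by (simp add: matrix_transpose_mul)
  qed
  ultimately have M: "M = U ** N ** transpose V"
    by (simp add: N_def matrix_mul_assoc)
  have "rank N \<le> CARD('r)"
    unfolding N_def using assms(1) rank_mul_le_left rank_mul_le_right by (metis order_trans)
  then obtain P :: "real^'r^'s1" and Q :: "real^'r^'s2"
    where N: "N = P ** transpose Q" and bal: "transpose P ** P = transpose Q ** Q"
    by (rule balanced_factorization_exists)

  fix \<theta>
  obtain A B where \<theta>: "\<theta> = vec_pair e A B" using \<open>bij e\<close> by (rule vec_pair_cases)
  obtain R where R: "orthogonal_matrix R" and psd: "psd ((transpose A ** P + transpose B ** Q) ** R)"
    by (rule polar_rotation_exists)
  have gram_U: "transpose (U ** F) ** (U ** G) = transpose F ** G"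
    for F G :: "real^'r^'s1"
    using assms(4) by (metis matrix_mul_assoc matrix_mul_lid matrix_transpose_mul)
  have gram_V: "transpose (V ** F) ** (V ** G) = transpose F ** G"
    for F G :: "real^'r^'s2"
    using assms(5) by (metis matrix_mul_assoc matrix_mul_lid matrix_transpose_mul)
  define \<xi> where "\<xi> = vec_pair e (P ** R) (Q ** R)"
  have "X \<xi> ** transpose (Y \<xi>) = U ** P ** (R ** transpose R) ** transpose Q ** transpose V"
    by (simp add: \<xi>_def X Y matrix_transpose_mul matrix_mul_assoc)
  also have "\<dots> = M"
    using R by (simp add: M N orthogonal_matrix_def matrix_mul_assoc)
  finally have "M = X \<xi> ** transpose (Y \<xi>)" ..
  moreover have "transpose (X \<xi>) ** X \<xi> = transpose (Y \<xi>) ** Y \<xi>"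
  proof -
    have "transpose (P ** R) ** (P ** R) = transpose R ** (transpose P ** P) ** R"
      by (simp add: matrix_transpose_mul matrix_mul_assoc)
    also have "\<dots> = transpose (Q ** R) ** (Q ** R)"
      unfolding bal by (simp add: matrix_transpose_mul matrix_mul_assoc)
    finally show ?thesis by (simp add: \<xi>_def X Y gram_U gram_V)
  qed
  moreover have "psd (transpose (X \<theta>) ** X \<xi> + transpose (Y \<theta>) ** Y \<xi>)"
    using psd by (simp add: \<theta> \<xi>_def X Y gram_U gram_V matrix_add_rdistrib
        flip: matrix_mul_assoc)
  ultimately show "\<exists>\<xi>. M = X \<xi> ** transpose (Y \<xi>)
      \<and> transpose (X \<xi>) ** X \<xi> = transpose (Y \<xi>) ** Y \<xi>
      \<and> psd (transpose (X \<theta>) ** X \<xi> + transpose (Y \<theta>) ** Y \<xi>)"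
    by blast
qed

end
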